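(* Let $X$ be a $d$-dimensional (real) Hilbert space, $1\le k<d$ and $\varepsilon>0$. Let $\Omega\subset X$ be an open convex set, $L>0$ and $f$ an $L$-Lipschitz convex function on $\Omega$. Denote (a) by $\Sigma^k_\varepsilon$ the set of all $x\in\Omega$ such that $\partial f(x)$ contains an open $k$-dimensional ball (i.e., a ball in a $k$-dimensional affine subspace of $X$) of radius $\varepsilon$, and (b) by $Z^k_\varepsilon$ the set of all $x\in\Omega$ for which there exists a $k$-dimensional linear space $K\subset X$ such that $$f'_+(x,v)+f'_+(x,-v)>\varepsilon\quad\text{whenever } v\in K \text{ and } |v|=1.$$ Then both $\Sigma^k_\varepsilon$ and $Z^k_\varepsilon$ can be covered by a finite number $N$ of $(d-k)$-dimensional DC surfaces, where $N=N(d,k,L,\varepsilon)$ depends only on $d$, $k$, $L$ and $\varepsilon$.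
   Context: $f'_+(x,v)$ is the one-sided directional derivative of $f$ at $x$ in direction $v$. $\partial f(x)$ is the (Clarke) subgradient, which for the continuous convex function $f$ is the usual convex subdifferential; $X^*$ is identified with $X$ in the standard way. A real function on an open convex set is DC if it is a difference of two continuous convex functions; a mapping $F$ into a finite-dimensional space $Y$ is DC if $y^*\circ F$ is DC for every $y^*\in Y^*$. A DC surface of dimension $j$ ($0<j<d$) in the $d$-dimensional Hilbert space $X$ is a set $\{w+\varphi(w): w\in W\}$, where $W\subset X$ is a $j$-dimensional linear subspace and $\varphi:W\to W^\perp$ is a Lipschitz DC mapping. *)

theory Defs
  imports "HOL-Analysis.Analysis"
begin

definition right_dir_deriv :: "('a::real_normed_vector \<Rightarrow> real) \<Rightarrow> 'a \<Rightarrow> 'a \<Rightarrow> real" where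
  "right_dir_deriv f x v = Lim (at_right 0) (\<lambda>t. (f (x + t *\<^sub>R v) - f x) / t)"

text \<open>Subdifferential of a convex function \<open>f\<close> with domain \<open>\<Omega>\<close>; functionals are identified with
  vectors through the inner product.\<close>

definition subdifferential :: "'a::real_inner set \<Rightarrow> ('a \<Rightarrow> real) \<Rightarrow> 'a \<Rightarrow> 'a set" where
  "subdifferential \<Omega> f x = {u. \<forall>y\<in>\<Omega>. f x + u \<bullet> (y - x) \<le> f y}"

definition Sigma_set :: "nat \<Rightarrow> real \<Rightarrow> 'a::euclidean_space set \<Rightarrow> ('a \<Rightarrow> real) \<Rightarrow> 'a set" where
  "Sigma_set k \<epsilon> \<Omega> f =
     {x \<in> \<Omega>. \<exists>A c. affine A \<and> aff_dim A = int k \<and> c \<in> A \<and> ball c \<epsilon> \<inter> A \<subseteq> subdifferential \<Omega> f x}"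

definition Z_set :: "nat \<Rightarrow> real \<Rightarrow> 'a::euclidean_space set \<Rightarrow> ('a \<Rightarrow> real) \<Rightarrow> 'a set" where
  "Z_set k \<epsilon> \<Omega> f =
     {x \<in> \<Omega>. \<exists>K. subspace K \<and> dim K = k \<and>
        (\<forall>v\<in>K. norm v = 1 \<longrightarrow> right_dir_deriv f x v + right_dir_deriv f x (- v) > \<epsilon>)}"

definition DC_on :: "'a::real_normed_vector set \<Rightarrow> ('a \<Rightarrow> real) \<Rightarrow> bool" where
  "DC_on C F \<longleftrightarrow> (\<exists>g h. convex_on C g \<and> continuous_on C g \<and> convex_on C h \<and> continuous_on C h \<and>
     (\<forall>x\<in>C. F x = g x - h x))"

definition DC_map_on ::
    "'a::real_normed_vector set \<Rightarrow> ('a \<Rightarrow> 'b::euclidean_space) \<Rightarrow> bool" where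
  "DC_map_on C F \<longleftrightarrow> (\<forall>l :: 'b \<Rightarrow> real. linear l \<longrightarrow> DC_on C (l \<circ> F))"

text \<open>The functionals on \<open>W\<^sup>\<bottom>\<close> are exactly the restrictions of the functionals on the whole space,
  so that \<open>DC_map_on W \<phi>\<close> says that \<open>\<phi>\<close> is DC as a mapping from the Hilbert space \<open>W\<close> (which is open
  in itself) to \<open>W\<^sup>\<bottom>\<close>.\<close>

definition DC_surface :: "nat \<Rightarrow> 'a::euclidean_space set \<Rightarrow> bool" where
  "DC_surface j S \<longleftrightarrow> 0 < j \<and> j < DIM('a) \<and>
     (\<exists>W \<phi>. subspace W \<and> dim W = j \<and> \<phi> ` W \<subseteq> W\<^sup>\<bottom> \<and> (\<exists>C. C-lipschitz_on W \<phi>) \<and> DC_map_on W \<phi> \<and>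
        S = {w + \<phi> w |w. w \<in> W})"

definition DC_coverable :: "nat \<Rightarrow> nat \<Rightarrow> 'a::euclidean_space set \<Rightarrow> bool" where
  "DC_coverable j N A \<longleftrightarrow>
     (\<exists>\<S>. finite \<S> \<and> card \<S> \<le> N \<and> (\<forall>S\<in>\<S>. DC_surface j S) \<and> A \<subseteq> \<Union>\<S>)"

text \<open>\<open>N\<close> surfaces suffice in the space \<open>'a\<close>, simultaneously for all domains and all functions.\<close>

definition uniform_DC_bound ::
    "'a::euclidean_space itself \<Rightarrow> nat \<Rightarrow> real \<Rightarrow> real \<Rightarrow> nat \<Rightarrow> bool" where
  "uniform_DC_bound (X :: 'a itself) k L \<epsilon> N \<longleftrightarrow>
     (\<forall>(\<Omega> :: 'a set) f. open \<Omega> \<and> convex \<Omega> \<and> L-lipschitz_on \<Omega> f \<and> convex_on \<Omega> f \<longrightarrow>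
        DC_coverable (DIM('a) - k) N (Sigma_set k \<epsilon> \<Omega> f) \<and>
        DC_coverable (DIM('a) - k) N (Z_set k \<epsilon> \<Omega> f))"

text \<open>HOL cannot quantify over types below an existential quantifier, so "there is \<open>N\<close> depending only
  on \<open>d, k, L, \<epsilon>\<close> that works in every \<open>d\<close>-dimensional Hilbert space" is to be expressed in two parts:
  some \<open>N\<close> satisfies \<open>uniform_DC_bound TYPE('a) k L \<epsilon> N\<close>, and every such \<open>N\<close> satisfies
  \<open>uniform_DC_bound TYPE('b) k L \<epsilon> N\<close> for each \<open>'b\<close> of the same dimension. Applied with any fixed
  \<open>d\<close>-dimensional \<open>'a\<close>, this yields one \<open>N\<close> for all \<open>'b\<close>.\<close>

end

theory Submission
  imports Defs
begin

text \<open>Extend \<open>f\<close> to a convex \<open>L\<close>-Lipschitz function \<open>F\<close> on the whole space; since \<open>\<Sigma> \<subseteq> Z\<close>, only \<open>Z\<close>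
  matters. At \<open>x \<in> Z\<close> the sublinear function \<open>F'\<^sub>+(x, \<cdot>)\<close> has width at least \<open>\<epsilon>\<close> in all directions of a
  \<open>k\<close>-dimensional subspace, hence at least \<open>\<epsilon>/2\<close> in all directions of a nearby \<open>K\<close> from a finite net,
  and so it dominates on \<open>K\<close> all functionals from a ball \<open>cball t \<rho>\<close>, with \<open>\<rho>\<close> independent of \<open>f\<close> and \<open>x\<close>
  and \<open>t\<close> from a finite net. For fixed \<open>(K, t)\<close>, the points \<open>x\<close> with this property minimise
  \<open>F - p\<close> on \<open>x + K\<close> for every \<open>p \<in> cball t \<rho>\<close>. The partial minima over \<open>K\<close> are convex functions on
  \<open>K\<^sup>\<bottom>\<close>, and their differences for various \<open>p\<close> are the coordinates of the \<open>K\<close>-component of \<open>x\<close>.\<close>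

section \<open>Convex Lipschitz functions\<close>

text \<open>Near-minimisers \<open>z\<close> and \<open>z'\<close> at \<open>y\<close> and
  \<open>y'\<close> combine to a competitor at the combined point, so joint convexity survives
  partial minimisation. This serves twice: for the extension of \<open>f\<close> and for the partial
  minima over a subspace.\<close>

lemma INF_jointly_convex_lipschitz:
  fixes G :: "'a::real_normed_vector \<Rightarrow> 'b::real_vector \<Rightarrow> real"
  assumes "convex C" "C \<noteq> {}" "0 \<le> L"
    and bdd: "\<And>y. bdd_below (G y ` C)"
    and joint: "\<And>u v y y' z z'. \<lbrakk>0 \<le> u; 0 \<le> v; u + v = 1; z \<in> C; z' \<in> C\<rbrakk> \<Longrightarrow>
      G (u *\<^sub>R y + v *\<^sub>R y') (u *\<^sub>R z + v *\<^sub>R z') \<le> u * G y z + v * G y' z'"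
    and lip: "\<And>y y' z. z \<in> C \<Longrightarrow> G y z \<le> G y' z + L * dist y y'"
  shows "convex_on UNIV (\<lambda>y. INF z\<in>C. G y z)"
    and "L-lipschitz_on UNIV (\<lambda>y. INF z\<in>C. G y z)"
proof -
  let ?g = "\<lambda>y. INF z\<in>C. G y z"
  have approx: "\<exists>z\<in>C. G y z < ?g y + e" if "e > 0" for y e
    using cINF_less_iff[OF \<open>C \<noteq> {}\<close> bdd, of y "?g y + e"] that by simp
  have low: "?g y \<le> G y z" if "z \<in> C" for y z
    by (rule cINF_lower[OF bdd that])
  show "convex_on UNIV ?g"
    unfolding convex_on_def
  proof (intro conjI ballI allI impI convex_UNIV)
    fix y y' :: 'a and u v :: real
    assume uv: "0 \<le> u" "0 \<le> v" "u + v = 1"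
    show "?g (u *\<^sub>R y + v *\<^sub>R y') \<le> u * ?g y + v * ?g y'"
    proof (rule field_le_epsilon)
      fix e :: real assume e: "e > 0"
      obtain z z' where z: "z \<in> C" "G y z < ?g y + e" "z' \<in> C" "G y' z' < ?g y' + e"
        using approx[OF e] by meson
      have "u *\<^sub>R z + v *\<^sub>R z' \<in> C"
        using \<open>convex C\<close> z uv by (simp add: convexD)
      then have "?g (u *\<^sub>R y + v *\<^sub>R y') \<le> u * G y z + v * G y' z'"
        using low joint[OF uv z(1,3)] by (meson order_trans)
      also have "\<dots> \<le> u * (?g y + e) + v * (?g y' + e)"
        using z uv by (intro add_mono mult_left_mono) auto
      also have "\<dots> = u * ?g y + v * ?g y' + (u + v) * e"
        by (simp add: algebra_simps)
      finally show "?g (u *\<^sub>R y + v *\<^sub>R y') \<le> u * ?g y + v * ?g y' + e"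
        using uv by simp
    qed
  qed
  have le: "?g y \<le> ?g y' + L * dist y y'" for y y'
  proof (rule field_le_epsilon)
    fix e :: real assume e: "e > 0"
    obtain z where z: "z \<in> C" "G y' z < ?g y' + e"
      using approx[OF e] by meson
    show "?g y \<le> ?g y' + L * dist y y' + e"
      using low[OF z(1), of y] lip[OF z(1), of y y'] z(2) by linarith
  qed
  show "L-lipschitz_on UNIV ?g"
  proof (rule lipschitz_onI)
    fix y y' :: 'a
    show "dist (?g y) (?g y') \<le> L * dist y y'"
      using le[of y y'] le[of y' y] by (simp add: dist_real_def dist_commute abs_le_iff)
  qed fact
qed

text \<open>The extension is the infimal convolution of \<open>f\<close> with \<open>L\<close> times
  the norm. The expression to be minimised is jointly convex, and the Lipschitz bound on
  \<open>\<Omega>\<close> makes \<open>z = x\<close> a minimiser when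
  \<open>x \<in> \<Omega>\<close>.\<close>

lemma convex_lipschitz_extension:
  fixes f :: "'a::real_normed_vector \<Rightarrow> real"
  assumes "convex_on \<Omega> f" and lip: "L-lipschitz_on \<Omega> f" and "\<Omega> \<noteq> {}"
  obtains F where "convex_on UNIV F" "L-lipschitz_on UNIV F" "\<And>x. x \<in> \<Omega> \<Longrightarrow> F x = f x"
proof -
  define G where "G y z = f z + L * dist y z" for y z
  have L: "0 \<le> L" using lip by (rule lipschitz_on_nonneg)
  have fl: "f x \<le> f z + L * dist x z" if "x \<in> \<Omega>" "z \<in> \<Omega>" for x z
    using lipschitz_onD[OF lip that] by (simp add: dist_real_def abs_le_iff)
  obtain x0 where x0: "x0 \<in> \<Omega>" using assms by auto
  have bdd: "bdd_below (G y ` \<Omega>)" for y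
  proof (rule bdd_belowI2)
    fix z assume z: "z \<in> \<Omega>"
    have "L * dist x0 z \<le> L * (dist x0 y + dist y z)"
      using L dist_triangle by (intro mult_left_mono) auto
    then show "f x0 - L * dist x0 y \<le> G y z"
      using fl[OF x0 z] by (simp add: G_def algebra_simps)
  qed
  have joint: "G (u *\<^sub>R y + v *\<^sub>R y') (u *\<^sub>R z + v *\<^sub>R z') \<le> u * G y z + v * G y' z'"
    if "0 \<le> u" "0 \<le> v" "u + v = 1" "z \<in> \<Omega>" "z' \<in> \<Omega>" for u v y y' z z'
  proof -
    have "norm (u *\<^sub>R (y - z) + v *\<^sub>R (y' - z')) \<le> u * norm (y - z) + v * norm (y' - z')"
      using that by (intro norm_triangle_le) simp
    then have "dist (u *\<^sub>R y + v *\<^sub>R y') (u *\<^sub>R z + v *\<^sub>R z') \<le> u * dist y z + v * dist y' z'"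
      by (simp add: dist_norm algebra_simps)
    then have "L * dist (u *\<^sub>R y + v *\<^sub>R y') (u *\<^sub>R z + v *\<^sub>R z') \<le> L * (u * dist y z + v * dist y' z')"
      using L by (rule mult_left_mono)
    moreover have "f (u *\<^sub>R z + v *\<^sub>R z') \<le> u * f z + v * f z'"
      using assms(1) that by (simp add: convex_on_def)
    ultimately show ?thesis
      by (simp add: G_def algebra_simps)
  qed
  have lipG: "G y z \<le> G y' z + L * dist y y'" for y y' z
  proof -
    have "L * dist y z \<le> L * (dist y y' + dist y' z)"
      using L dist_triangle by (intro mult_left_mono) auto
    then show ?thesis by (simp add: G_def algebra_simps)
  qed
  have C: "convex \<Omega>" using assms(1) by (simp add: convex_on_def)
  have eq: "(INF z\<in>\<Omega>. G x z) = f x" if "x \<in> \<Omega>" for x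
  proof (rule antisym)
    show "(INF z\<in>\<Omega>. G x z) \<le> f x"
      using cINF_lower[OF bdd that, of x] by (simp add: G_def)
    show "f x \<le> (INF z\<in>\<Omega>. G x z)"
      using fl[OF that] by (intro cINF_greatest) (auto simp: G_def \<open>\<Omega> \<noteq> {}\<close>)
  qed
  show thesis
  proof (rule that)
    show "convex_on UNIV (\<lambda>y. INF z\<in>\<Omega>. G y z)" "L-lipschitz_on UNIV (\<lambda>y. INF z\<in>\<Omega>. G y z)"
      by (rule INF_jointly_convex_lipschitz[where G = G, OF C \<open>\<Omega> \<noteq> {}\<close> L bdd joint lipG]; assumption)+
  qed (rule eq)
qed

section \<open>One-sided directional derivatives and subgradients\<close>

text \<open>By convexity the difference quotients are nondecreasing in \<open>t\<close>, so their
  limit at 0 exists and equals their infimum \<open>\<sigma> v\<close>. All five facts come from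
  this description; the last three are those collected later in \<open>sublinear\<close>.\<close>

lemma right_dir_deriv_convex:
  fixes F :: "'a::real_normed_vector \<Rightarrow> real"
  assumes conv: "convex_on UNIV F" and lip: "L-lipschitz_on UNIV F"
  shows "((\<lambda>t. (F (x + t *\<^sub>R v) - F x) / t) \<longlongrightarrow> right_dir_deriv F x v) (at_right 0)"
    and "t > 0 \<Longrightarrow> right_dir_deriv F x v \<le> (F (x + t *\<^sub>R v) - F x) / t"
    and "right_dir_deriv F x v \<le> L * norm v"
    and "right_dir_deriv F x (u + v) \<le> right_dir_deriv F x u + right_dir_deriv F x v"
    and "s \<ge> 0 \<Longrightarrow> right_dir_deriv F x (s *\<^sub>R v) = s * right_dir_deriv F x v"
proof -
  define q where "q v t = (F (x + t *\<^sub>R v) - F x) / t" for v t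
  define \<sigma> where "\<sigma> v = (INF t\<in>{0<..}. q v t)" for v
  have abs_le: "\<bar>F (x + t *\<^sub>R v) - F x\<bar> \<le> t * (L * norm v)" if "t > 0" for t v
    using lipschitz_onD[OF lip, of "x + t *\<^sub>R v" x] that by (simp add: dist_norm algebra_simps)
  have q_abs: "\<bar>q v t\<bar> \<le> L * norm v" if "t > 0" for v t
    using abs_le[OF that, of v] that by (simp add: q_def pos_divide_le_eq mult.commute)
  have bdd: "bdd_below (q v ` {0<..})" for v
  proof (rule bdd_belowI2)
    fix t :: real assume "t \<in> {0<..}"
    then show "- (L * norm v) \<le> q v t" using q_abs[of t v] by auto
  qed
  have low: "\<sigma> v \<le> q v t" if "t > 0" for v t
    unfolding \<sigma>_def using that by (intro cINF_lower bdd) auto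
  have approx: "\<exists>t>0. q v t < a" if "\<sigma> v < a" for v a
    using cINF_less_iff[OF _ bdd, of v a] that by (auto simp: \<sigma>_def)
  \<comment> \<open>The nearer point lies on the segment from \<open>x\<close> to the farther one,
    with weight \<open>s/t\<close> at the far end.\<close>
  have mono: "q v s \<le> q v t" if "0 < s" "s \<le> t" for v s t
  proof -
    have "F ((1 - s/t) *\<^sub>R x + (s/t) *\<^sub>R (x + t *\<^sub>R v)) \<le> (1 - s/t) * F x + (s/t) * F (x + t *\<^sub>R v)"
      using that by (intro convex_onD[OF conv]) auto
    moreover have "(1 - s/t) *\<^sub>R x + (s/t) *\<^sub>R (x + t *\<^sub>R v) = x + s *\<^sub>R v"
      using that by (simp add: algebra_simps)
    ultimately have "F (x + s *\<^sub>R v) - F x \<le> s * q v t"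
      using that by (simp add: q_def algebra_simps diff_divide_distrib)
    then show ?thesis using that by (simp add: q_def[of v s] pos_divide_le_eq mult.commute)
  qed
  have lim: "(q v \<longlongrightarrow> \<sigma> v) (at_right 0)" for v
  proof (rule order_tendstoI)
    fix a assume "a < \<sigma> v"
    then have "a < q v t" if "t > 0" for t using low[OF that] by (rule less_le_trans)
    then show "\<forall>\<^sub>F t in at_right 0. a < q v t"
      by (intro eventually_at_rightI[of 0 1]) auto
  next
    fix a assume "\<sigma> v < a"
    then obtain t0 where t0: "t0 > 0" "q v t0 < a" using approx by blast
    then have "q v t < a" if "t \<in> {0<..<t0}" for t using mono[of t t0 v] that by auto
    then show "\<forall>\<^sub>F t in at_right 0. q v t < a"
      using t0 by (intro eventually_at_rightI[of 0 t0]) auto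
  qed
  have eq: "right_dir_deriv F x v = \<sigma> v" for v
    unfolding right_dir_deriv_def
    by (rule tendsto_Lim) (use lim[of v] in \<open>auto simp: q_def[abs_def]\<close>)
  show "((\<lambda>t. (F (x + t *\<^sub>R v) - F x) / t) \<longlongrightarrow> right_dir_deriv F x v) (at_right 0)"
    using lim[of v] by (simp add: q_def[abs_def] eq)
  show "right_dir_deriv F x v \<le> (F (x + t *\<^sub>R v) - F x) / t" if "t > 0"
    using low[OF that] by (simp add: eq q_def)
  show "right_dir_deriv F x v \<le> L * norm v"
    using low[of 1 v] q_abs[of 1 v] by (simp add: eq)
  show "right_dir_deriv F x (u + v) \<le> right_dir_deriv F x u + right_dir_deriv F x v"
    unfolding eq
  proof (rule field_le_epsilon)
    fix e :: real assume "e > 0"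
    then obtain s t where st: "s > 0" "q u s < \<sigma> u + e/2" "t > 0" "q v t < \<sigma> v + e/2"
      using approx[of u "\<sigma> u + e/2"] approx[of v "\<sigma> v + e/2"] by auto
    \<comment> \<open>Good step lengths for \<open>u\<close> and \<open>v\<close> may differ; by
      \<open>mono\<close> the smaller one serves both. The midpoint of the two resulting points
      tests the direction \<open>u + v\<close> with step \<open>m/2\<close>.\<close>
    define m where "m = min s t"
    have m: "m > 0" "m \<le> s" "m \<le> t" using st by (auto simp: m_def)
    have mid: "(1 - 1/2) *\<^sub>R (x + m *\<^sub>R u) + (1/2) *\<^sub>R (x + m *\<^sub>R v) = x + (m/2) *\<^sub>R (u + v)"
      by (simp add: algebra_simps flip: scaleR_add_left)
    have "F ((1 - 1/2) *\<^sub>R (x + m *\<^sub>R u) + (1/2) *\<^sub>R (x + m *\<^sub>R v)) \<le>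
        (1 - 1/2) * F (x + m *\<^sub>R u) + (1/2) * F (x + m *\<^sub>R v)"
      by (intro convex_onD[OF conv]) auto
    then have "F (x + (m/2) *\<^sub>R (u + v)) \<le> (F (x + m *\<^sub>R u) + F (x + m *\<^sub>R v)) / 2"
      unfolding mid by simp
    moreover have "m * q w m = F (x + m *\<^sub>R w) - F x" for w
      using m by (simp add: q_def)
    moreover have "(m/2) * (q u m + q v m) = (m * q u m + m * q v m) / 2"
      by (simp add: distrib_left)
    ultimately have "F (x + (m/2) *\<^sub>R (u + v)) - F x \<le> (m/2) * (q u m + q v m)"
      by simp
    then have "q (u + v) (m/2) \<le> q u m + q v m"
      using m by (simp add: q_def[of "u + v"] pos_divide_le_eq mult.commute)
    then show "\<sigma> (u + v) \<le> \<sigma> u + \<sigma> v + e"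
      using low[of "m/2" "u + v"] mono[OF m(1,2), of u] mono[OF m(1,3), of v] st m by simp
  qed
  have ge: "s * \<sigma> v \<le> \<sigma> (s *\<^sub>R v)" if "s > 0" for s v
    unfolding \<sigma>_def[of "s *\<^sub>R v"]
  proof (rule cINF_greatest)
    fix t :: real assume t: "t \<in> {0<..}"
    have "s * \<sigma> v \<le> s * q v (t * s)"
      using low[of "t * s" v] t that by (intro mult_left_mono) auto
    also have "\<dots> = q (s *\<^sub>R v) t"
      using t that by (simp add: q_def field_simps)
    finally show "s * \<sigma> v \<le> q (s *\<^sub>R v) t" .
  qed auto
  show "right_dir_deriv F x (s *\<^sub>R v) = s * right_dir_deriv F x v" if "s \<ge> 0"
  proof (cases "s = 0")
    case True
    \<comment> \<open>The quotient in direction 0 vanishes, which bounds \<open>\<sigma> 0\<close>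
      from above; \<open>ge\<close> with factor \<open>1/2\<close> excludes a negative
      value.\<close>
    have "\<sigma> 0 = 0" using low[of 1 0] ge[of "1/2" 0] by (simp add: q_def)
    with True show ?thesis by (simp add: eq)
  next
    case False
    \<comment> \<open>The missing inequality is \<open>ge\<close> itself, with factor
      \<open>1/s\<close> in the scaled direction.\<close>
    then have "(1/s) * \<sigma> (s *\<^sub>R v) \<le> \<sigma> ((1/s) *\<^sub>R s *\<^sub>R v)" using that by (intro ge) auto
    then have "\<sigma> (s *\<^sub>R v) \<le> s * \<sigma> v" using False that by (simp add: field_simps)
    with ge[of s v] False that show ?thesis by (simp add: eq)
  qed
qed

lemma eventually_at_right_in_open:
  fixes x v :: "'a::real_normed_vector"
  assumes "open \<Omega>" "x \<in> \<Omega>"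
  shows "\<forall>\<^sub>F t in at_right 0. x + t *\<^sub>R v \<in> \<Omega>"
proof -
  have "((\<lambda>t. x + t *\<^sub>R v) \<longlongrightarrow> x + 0 *\<^sub>R v) (at_right 0)" by (intro tendsto_intros)
  then show ?thesis using assms by (auto simp: tendsto_def)
qed

text \<open>The quotients agree for small \<open>t\<close>. As \<open>Lim\<close> is a definite
  description, it is enough that both have exactly the same limits, whether or not one
  exists.\<close>

lemma right_dir_deriv_eq_of_eq_on_open:
  assumes "open \<Omega>" "x \<in> \<Omega>" and eq: "\<And>y. y \<in> \<Omega> \<Longrightarrow> F y = f y"
  shows "right_dir_deriv f x v = right_dir_deriv F x v"
proof -
  have "((\<lambda>t. (f (x + t *\<^sub>R v) - f x) / t) \<longlongrightarrow> l) (at_right 0) \<longleftrightarrow>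
      ((\<lambda>t. (F (x + t *\<^sub>R v) - F x) / t) \<longlongrightarrow> l) (at_right 0)" for l
    by (rule tendsto_cong, use eventually_at_right_in_open[OF assms(1,2), of v] in eventually_elim)
      (use eq assms(2) in simp)
  then show ?thesis
    by (simp add: right_dir_deriv_def Topological_Spaces.Lim_def)
qed

text \<open>The subgradient inequality bounds the quotients from below for small \<open>t\<close>.
  The limit is taken for the extension \<open>F\<close>, whose quotients are known to
  converge.\<close>

lemma subgradient_le_right_dir_deriv:
  assumes "open \<Omega>" "x \<in> \<Omega>" "convex_on \<Omega> f" "L-lipschitz_on \<Omega> f" "u \<in> subdifferential \<Omega> f x"
  shows "u \<bullet> v \<le> right_dir_deriv f x v"
proof -
  obtain F where F: "convex_on UNIV F" "L-lipschitz_on UNIV F" "\<And>x. x \<in> \<Omega> \<Longrightarrow> F x = f x"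
    using convex_lipschitz_extension[OF assms(3,4)] assms(2) by blast
  have "\<forall>\<^sub>F t in at_right 0. u \<bullet> v \<le> (F (x + t *\<^sub>R v) - F x) / t"
    using eventually_at_right_in_open[OF assms(1,2), of v] eventually_at_right_less[of 0]
  proof eventually_elim
    case (elim t)
    then have "f x + u \<bullet> (x + t *\<^sub>R v - x) \<le> f (x + t *\<^sub>R v)"
      using assms(5) by (auto simp: subdifferential_def)
    then show ?case using F(3) assms(2) elim by (simp add: pos_le_divide_eq mult.commute)
  qed
  then have "u \<bullet> v \<le> right_dir_deriv F x v"
    by (rule tendsto_lowerbound[OF right_dir_deriv_convex(1)[OF F(1,2)]]) simp
  then show ?thesis using right_dir_deriv_eq_of_eq_on_open[OF assms(1,2) F(3)] by simp
qed

text \<open>The direction space of \<open>A\<close> serves as \<open>K\<close>: for a unit vector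
  \<open>v\<close> in it, subgradients displaced from \<open>c\<close> along \<open>v\<close> and
  along \<open>- v\<close> bound the two derivatives from below.\<close>

lemma Sigma_set_subset_Z_set:
  fixes f :: "'a::euclidean_space \<Rightarrow> real"
  assumes "open \<Omega>" "convex_on \<Omega> f" "L-lipschitz_on \<Omega> f" "\<epsilon> > 0"
  shows "Sigma_set k \<epsilon> \<Omega> f \<subseteq> Z_set k \<epsilon> \<Omega> f"
proof
  fix x assume "x \<in> Sigma_set k \<epsilon> \<Omega> f"
  then obtain A c where x: "x \<in> \<Omega>" and A: "affine A" "aff_dim A = int k" "c \<in> A"
    and sub: "ball c \<epsilon> \<inter> A \<subseteq> subdifferential \<Omega> f x"
    by (auto simp: Sigma_set_def)
  define K where "K = (\<lambda>a. a - c) ` A"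
  have K: "subspace K" unfolding K_def using A affine_diffs_subspace_subtract by blast
  have "aff_dim K = aff_dim A"
    unfolding K_def using aff_dim_translation_eq[of "- c" A] by simp
  then have "dim K = k" using A aff_dim_subspace[OF K] by simp
  moreover have "right_dir_deriv f x v + right_dir_deriv f x (- v) > \<epsilon>" if v: "v \<in> K" "norm v = 1" for v
  proof -
    have u: "(c + s *\<^sub>R v) \<in> subdifferential \<Omega> f x" if "\<bar>s\<bar> < \<epsilon>" for s
    proof -
      have "s *\<^sub>R v \<in> K" using K v by (simp add: subspace_scale)
      then have "c + s *\<^sub>R v \<in> A" by (auto simp: K_def algebra_simps)
      moreover have "c + s *\<^sub>R v \<in> ball c \<epsilon>" using that v by (simp add: dist_norm)
      ultimately show ?thesis using sub by blast
    qed
    \<comment> \<open>Any factor strictly between 1/2 and 1 would do: the points stay in the open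
      ball, and the two bounds add up to \<open>3/2 * \<epsilon>\<close>, as the contributions of
      \<open>c\<close> cancel.\<close>
    have "(c + (3/4 * \<epsilon>) *\<^sub>R v) \<bullet> v \<le> right_dir_deriv f x v"
      "(c + (- 3/4 * \<epsilon>) *\<^sub>R v) \<bullet> (- v) \<le> right_dir_deriv f x (- v)"
      using assms x by (intro subgradient_le_right_dir_deriv[of \<Omega> _ _ L] u; simp)+
    moreover have "v \<bullet> v = 1" using v by (simp add: dot_square_norm)
    ultimately show ?thesis using assms by (simp add: inner_add_left inner_diff_left)
  qed
  ultimately show "x \<in> Z_set k \<epsilon> \<Omega> f" using x K by (auto simp: Z_set_def)
qed

section \<open>Sublinear functions of positive width\<close>

text \<open>On a Euclidean space these are the support functions of nonempty compact convex subsets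
  of \<open>cball 0 L\<close>.\<close>

definition sublinear :: "real \<Rightarrow> ('a::real_normed_vector \<Rightarrow> real) \<Rightarrow> bool" where
  "sublinear L \<sigma> \<longleftrightarrow> (\<forall>u v. \<sigma> (u + v) \<le> \<sigma> u + \<sigma> v) \<and>
     (\<forall>s v. 0 \<le> s \<longrightarrow> \<sigma> (s *\<^sub>R v) = s * \<sigma> v) \<and> (\<forall>v. \<sigma> v \<le> L * norm v)"

lemma sublinear_zero: "sublinear L \<sigma> \<Longrightarrow> \<sigma> 0 = 0"
  unfolding sublinear_def by (metis mult_zero_left order_refl scale_zero_left)

lemma sublinear_lipschitz:
  assumes "sublinear L \<sigma>"
  shows "\<sigma> u - L * norm (u - v) \<le> \<sigma> v"
proof -
  have "\<sigma> (v + (u - v)) \<le> \<sigma> v + \<sigma> (u - v)" "\<sigma> (u - v) \<le> L * norm (u - v)"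
    using assms unfolding sublinear_def by blast+
  then show ?thesis by simp
qed

text \<open>The domination is tested at the vector \<open>c\<close> itself. The bound later confines
  all centres to a compact ball, where a finite net exists.\<close>

lemma norm_le_of_dominated:
  fixes c :: "'a::real_inner"
  assumes "sublinear L \<sigma>" "c \<bullet> c \<le> \<sigma> c" "0 \<le> L"
  shows "norm c \<le> L"
proof (cases "c = 0")
  case False
  have "norm c * norm c \<le> L * norm c"
    using assms by (metis order_trans power2_eq_square power2_norm_eq_inner sublinear_def)
  with False show ?thesis by simp
qed (use assms in simp)

text \<open>The inductive step is the one-dimensional Hahn--Banach extension, carried out with a margin:
  positive width of \<open>\<sigma>\<close> in every direction makes the interval of admissible values of the extension
  in the new direction \<open>q\<close> non-degenerate, and an interior value keeps a distance from \<open>\<sigma>\<close>.\<close>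

lemma sublinear_margin_step:
  fixes K :: "'a::euclidean_space set"
  assumes \<sigma>: "sublinear L \<sigma>" and K: "subspace K" and q: "q \<in> K" "norm q = 1"
    and width: "\<And>v. v \<in> K \<Longrightarrow> \<epsilon> * norm v \<le> \<sigma> v + \<sigma> (- v)"
    and c1: "c1 \<in> K" "c1 \<bullet> q = 0" "\<And>v. v \<in> K \<Longrightarrow> v \<bullet> q = 0 \<Longrightarrow> c1 \<bullet> v + \<rho> * norm v \<le> \<sigma> v"
    and pos: "0 < \<epsilon>" "0 < L" "0 < \<rho>"
  defines "\<gamma> \<equiv> min (\<rho> * (\<epsilon> / (4 * L))) (\<epsilon> / 2)"
  shows "\<exists>c\<in>K. \<forall>v\<in>K. c \<bullet> v + \<rho> / (1 + 4 * L / \<gamma> + 2 * \<rho> / \<gamma>) * norm v \<le> \<sigma> v"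
proof -
  let ?\<eta> = "\<epsilon> / (4 * L)"
  define H where "H = {v \<in> K. v \<bullet> q = 0}"
  have \<gamma>: "0 < \<gamma>" using pos by (simp add: \<gamma>_def)
  have sub: "\<sigma> (u + v) \<le> \<sigma> u + \<sigma> v" and hom: "0 \<le> s \<Longrightarrow> \<sigma> (s *\<^sub>R v) = s * \<sigma> v"
    and bound: "\<sigma> v \<le> L * norm v" for u v s
    using \<sigma> unfolding sublinear_def by blast+
  have qq: "q \<bullet> q = 1" using q by (simp add: dot_square_norm)
  have H0: "0 \<in> H" using K by (simp add: H_def subspace_0)
  have Hadd: "e + e' \<in> H" if "e \<in> H" "e' \<in> H" for e e'
    using that K by (simp add: H_def subspace_add inner_add_left)
  have Hscale: "s *\<^sub>R e \<in> H" if "e \<in> H" for e s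
    using that K by (simp add: H_def subspace_scale)
  have "c1 \<bullet> c1 \<le> \<sigma> c1"
    using c1(3)[OF c1(1,2)] pos by (smt (verit) mult_nonneg_nonneg norm_ge_zero)
  then have normc1: "norm c1 \<le> L" using norm_le_of_dominated[OF \<sigma>] pos by simp
  \<comment> \<open>This bounds from below the length of the interval of admissible values at
    \<open>q\<close>. If \<open>e + e'\<close> is long, the margin of \<open>c1\<close> on
    \<open>H\<close> gives \<open>\<rho> * ?\<eta>\<close>. If it is short, \<open>e' - q\<close> is
    close to \<open>- (e + q)\<close>, and the width \<open>\<epsilon>\<close> survives up to two
    errors of at most \<open>\<epsilon> / 4\<close> each.\<close>
  have gap: "\<gamma> \<le> (\<sigma> (e + q) - c1 \<bullet> e) + (\<sigma> (e' - q) - c1 \<bullet> e')" if "e \<in> H" "e' \<in> H" for e e'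
  proof -
    let ?s = "e + e'"
    have s: "?s \<in> H" using that by (rule Hadd)
    show ?thesis
    proof (cases "?\<eta> \<le> norm ?s")
      case True
      have "\<sigma> ?s \<le> \<sigma> (e + q) + \<sigma> (e' - q)"
        using sub[of "e + q" "e' - q"] by (simp add: algebra_simps)
      moreover have "c1 \<bullet> ?s + \<rho> * norm ?s \<le> \<sigma> ?s" using s c1(3) by (simp add: H_def)
      moreover have "\<rho> * ?\<eta> \<le> \<rho> * norm ?s" using True pos by (intro mult_left_mono) auto
      ultimately show ?thesis by (simp add: \<gamma>_def inner_add_right)
    next
      case False
      let ?z = "e + q"
      have "?z \<in> K" using that q K by (simp add: H_def subspace_add)
      then have "\<epsilon> * norm ?z \<le> \<sigma> ?z + \<sigma> (- ?z)" by (rule width)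
      moreover have "1 \<le> norm ?z"
      proof -
        have "?z \<bullet> q = 1" using that qq by (simp add: H_def inner_add_left)
        then show ?thesis using Cauchy_Schwarz_ineq2[of ?z q] q by simp
      qed
      then have "\<epsilon> * 1 \<le> \<epsilon> * norm ?z" using pos by (intro mult_left_mono) auto
      moreover have "\<sigma> (- ?z) - L * norm ?s \<le> \<sigma> (e' - q)"
        using sublinear_lipschitz[OF \<sigma>, of "- ?z" "e' - q"]
        by (simp add: norm_minus_commute add.commute)
      moreover have "c1 \<bullet> ?s \<le> L * norm ?s"
        using norm_cauchy_schwarz[of c1 ?s] normc1 by (meson mult_right_mono norm_ge_zero order_trans)
      moreover have "L * norm ?s \<le> L * ?\<eta>" using False pos by (intro mult_left_mono) auto
      then have "L * norm ?s \<le> \<epsilon> / 4" using pos by simp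
      ultimately have "\<epsilon> / 2 \<le> \<sigma> (e + q) + \<sigma> (e' - q) - c1 \<bullet> ?s" by linarith
      then show ?thesis by (simp add: \<gamma>_def inner_add_right min_le_iff_disj)
    qed
  qed
  \<comment> \<open>\<open>a\<close> is the upper end of that interval. Going down by
    \<open>\<gamma> / 2\<close> keeps distance at least \<open>\<gamma> / 2\<close> from both ends,
    as \<open>plus\<close> and \<open>minus\<close> record.\<close>
  define a where "a = (INF e\<in>H. \<sigma> (e + q) - c1 \<bullet> e)"
  define c where "c = c1 + (a - \<gamma> / 2) *\<^sub>R q"
  have a_ge: "\<gamma> - (\<sigma> (e' - q) - c1 \<bullet> e') \<le> a" if "e' \<in> H" for e'
    unfolding a_def using gap[OF _ that] H0 by (intro cINF_greatest) (auto simp: algebra_simps)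
  have "bdd_below ((\<lambda>e. \<sigma> (e + q) - c1 \<bullet> e) ` H)"
    by (rule bdd_belowI2[of _ "\<gamma> - (\<sigma> (0 - q) - c1 \<bullet> 0)"]) (use gap[OF _ H0] in \<open>force simp: algebra_simps\<close>)
  then have a_le: "a \<le> \<sigma> (e + q) - c1 \<bullet> e" if "e \<in> H" for e
    unfolding a_def using that by (rule cINF_lower)
  have cK: "c \<in> K" using c1 q K by (simp add: c_def subspace_add subspace_scale)
  have cq: "c \<bullet> q = a - \<gamma> / 2" using c1 qq by (simp add: c_def inner_add_left)
  have cH: "c \<bullet> e = c1 \<bullet> e" if "e \<in> H" for e
    using that by (simp add: H_def c_def inner_add_left inner_commute[of q])
  have plus: "c \<bullet> (e + q) + \<gamma> / 2 \<le> \<sigma> (e + q)" if "e \<in> H" for e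
    using a_le[OF that] by (simp add: inner_add_right cH[OF that] cq)
  have minus: "c \<bullet> (e - q) + \<gamma> / 2 \<le> \<sigma> (e - q)" if "e \<in> H" for e
    using a_ge[OF that] by (simp add: inner_diff_right cH[OF that] cq)
  have decomp: "v - (v \<bullet> q) *\<^sub>R q \<in> H" if "v \<in> K" for v
    using that K q qq by (simp add: H_def subspace_diff subspace_scale inner_diff_left)
  \<comment> \<open>Homogeneity carries \<open>plus\<close> and \<open>minus\<close> to all of
    \<open>K\<close>. The resulting margin is proportional to the \<open>q\<close>-component only
    and vanishes on \<open>H\<close>.\<close>
  have first: "\<bar>v \<bullet> q\<bar> * \<gamma> / 2 \<le> \<sigma> v - c \<bullet> v" if v: "v \<in> K" for v
  proof -
    define t where "t = v \<bullet> q"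
    define e where "e = v - t *\<^sub>R q"
    have e: "e \<in> H" using decomp[OF v] by (simp add: e_def t_def)
    consider "t = 0" | "t > 0" | "t < 0" by linarith
    then show ?thesis
    proof cases
      case 1
      then have "v \<in> H" using v by (simp add: H_def t_def)
      then have "c \<bullet> v + \<rho> * norm v \<le> \<sigma> v" using c1(3) cH by (simp add: H_def)
      moreover have "0 \<le> \<rho> * norm v" using pos by simp
      ultimately show ?thesis using 1 unfolding t_def by simp
    next
      case 2
      have v_eq: "v = t *\<^sub>R ((1/t) *\<^sub>R e + q)" using 2 by (simp add: e_def algebra_simps)
      have "t * (c \<bullet> ((1/t) *\<^sub>R e + q) + \<gamma> / 2) \<le> t * \<sigma> ((1/t) *\<^sub>R e + q)"
        using 2 by (intro mult_left_mono plus Hscale e) auto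
      also have "\<dots> = \<sigma> v" using hom[of t "(1/t) *\<^sub>R e + q", folded v_eq] 2 by simp
      finally have "t * (c \<bullet> ((1/t) *\<^sub>R e + q)) + t * \<gamma> / 2 \<le> \<sigma> v" by (simp add: algebra_simps)
      moreover have "t * (c \<bullet> ((1/t) *\<^sub>R e + q)) = c \<bullet> v" using v_eq by (metis inner_scaleR_right)
      ultimately show ?thesis using 2 unfolding t_def by simp
    next
      case 3
      have v_eq: "v = (-t) *\<^sub>R ((1/(-t)) *\<^sub>R e - q)" using 3 by (simp add: e_def algebra_simps)
      have "(-t) * (c \<bullet> ((1/(-t)) *\<^sub>R e - q) + \<gamma> / 2) \<le> (-t) * \<sigma> ((1/(-t)) *\<^sub>R e - q)"
        using 3 by (intro mult_left_mono minus Hscale e) auto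
      also have "\<dots> = \<sigma> v" using hom[of "-t" "(1/(-t)) *\<^sub>R e - q", folded v_eq] 3 by simp
      finally have "(-t) * (c \<bullet> ((1/(-t)) *\<^sub>R e - q)) + (-t) * \<gamma> / 2 \<le> \<sigma> v"
        by (simp add: algebra_simps)
      moreover have "(-t) * (c \<bullet> ((1/(-t)) *\<^sub>R e - q)) = c \<bullet> v" using v_eq by (metis inner_scaleR_right)
      ultimately show ?thesis using 3 unfolding t_def by simp
    qed
  qed
  have "c \<bullet> c \<le> \<sigma> c"
    using first[OF cK] \<gamma> by (smt (verit) abs_ge_zero divide_nonneg_pos mult_nonneg_nonneg)
  then have normc: "norm c \<le> L" using norm_le_of_dominated[OF \<sigma>] pos by simp
  \<comment> \<open>The margin on \<open>H\<close> controls the component \<open>e\<close>, with an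
    error proportional to \<open>\<bar>t\<bar>\<close>. By \<open>first\<close>, every such term is
    at most a multiple of the slack \<open>X\<close>; collecting the multiples gives the
    denominator.\<close>
  have "c \<bullet> v + \<rho> / (1 + 4 * L / \<gamma> + 2 * \<rho> / \<gamma>) * norm v \<le> \<sigma> v" if v: "v \<in> K" for v
  proof -
    define t where "t = v \<bullet> q"
    define e where "e = v - t *\<^sub>R q"
    define X where "X = \<sigma> v - c \<bullet> v"
    have e: "e \<in> H" using decomp[OF v] by (simp add: e_def t_def)
    have X1: "\<bar>t\<bar> * \<gamma> / 2 \<le> X" using first[OF v] by (simp add: t_def X_def)
    have "\<sigma> e - L * \<bar>t\<bar> \<le> \<sigma> v"
      using sublinear_lipschitz[OF \<sigma>, of e v] q by (simp add: e_def)
    moreover have "c \<bullet> e + \<rho> * norm e \<le> \<sigma> e" using e c1(3) cH by (simp add: H_def)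
    moreover have "c \<bullet> v - c \<bullet> e \<le> L * \<bar>t\<bar>"
    proof -
      have "c \<bullet> v - c \<bullet> e = c \<bullet> (t *\<^sub>R q)" by (simp add: e_def inner_diff_right)
      also have "\<dots> \<le> norm c * norm (t *\<^sub>R q)" by (rule norm_cauchy_schwarz)
      also have "\<dots> = norm c * \<bar>t\<bar>" using q by simp
      also have "\<dots> \<le> L * \<bar>t\<bar>" using normc by (intro mult_right_mono) auto
      finally show ?thesis .
    qed
    ultimately have X2: "\<rho> * norm e - 2 * L * \<bar>t\<bar> \<le> X" by (simp add: X_def)
    have "2 * L * \<bar>t\<bar> = (4 * L / \<gamma>) * (\<bar>t\<bar> * \<gamma> / 2)" using \<gamma> by simp
    also have "\<dots> \<le> (4 * L / \<gamma>) * X" using X1 pos \<gamma> by (intro mult_left_mono) auto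
    finally have X3: "2 * L * \<bar>t\<bar> \<le> (4 * L / \<gamma>) * X" .
    have "\<rho> * \<bar>t\<bar> = (2 * \<rho> / \<gamma>) * (\<bar>t\<bar> * \<gamma> / 2)" using \<gamma> by simp
    also have "\<dots> \<le> (2 * \<rho> / \<gamma>) * X" using X1 pos \<gamma> by (intro mult_left_mono) auto
    finally have X4: "\<rho> * \<bar>t\<bar> \<le> (2 * \<rho> / \<gamma>) * X" .
    have "norm v \<le> norm e + \<bar>t\<bar>"
      using norm_triangle_ineq[of e "t *\<^sub>R q"] q by (simp add: e_def)
    then have "\<rho> * norm v \<le> \<rho> * (norm e + \<bar>t\<bar>)" using pos by (intro mult_left_mono) auto
    then have "\<rho> * norm v \<le> X + (4 * L / \<gamma>) * X + (2 * \<rho> / \<gamma>) * X"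
      using X2 X3 X4 by (simp add: distrib_left)
    then have "\<rho> * norm v \<le> X * (1 + 4 * L / \<gamma> + 2 * \<rho> / \<gamma>)" by (simp add: algebra_simps)
    moreover have "0 < 1 + 4 * L / \<gamma> + 2 * \<rho> / \<gamma>" using pos \<gamma> by (simp add: add_pos_pos)
    ultimately have "\<rho> / (1 + 4 * L / \<gamma> + 2 * \<rho> / \<gamma>) * norm v \<le> X"
      by (simp add: pos_divide_le_eq)
    then show ?thesis by (simp add: X_def)
  qed
  with cK show ?thesis by blast
qed

text \<open>The conclusion says that \<open>\<sigma>\<close> dominates on \<open>K\<close> every
  functional in \<open>cball c \<rho>\<close>. Induction on the dimension splits off one unit vector
  at a time. The order of quantifiers matters: \<open>\<rho>\<close> is fixed before
  \<open>K\<close> and \<open>\<sigma>\<close>.\<close>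

lemma sublinear_margin:
  assumes pos: "0 < \<epsilon>" "0 < L"
  shows "\<exists>\<rho>>0. \<forall>(K :: 'a::euclidean_space set) \<sigma>. subspace K \<and> dim K = k \<and> sublinear L \<sigma> \<and>
    (\<forall>v\<in>K. \<epsilon> * norm v \<le> \<sigma> v + \<sigma> (- v)) \<longrightarrow> (\<exists>c\<in>K. \<forall>v\<in>K. c \<bullet> v + \<rho> * norm v \<le> \<sigma> v)"
proof (induction k)
  case 0
  \<comment> \<open>The value 1 is arbitrary, since 0 is the only vector of
    \<open>K\<close>.\<close>
  show ?case
  proof (intro exI[of _ 1] conjI allI impI)
    fix K :: "'a set" and \<sigma> :: "'a \<Rightarrow> real"
    assume *: "subspace K \<and> dim K = 0 \<and> sublinear L \<sigma> \<and> (\<forall>v\<in>K. \<epsilon> * norm v \<le> \<sigma> v + \<sigma> (- v))"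
    then have "K = {0}" by (metis dim_eq_0 subset_singletonD subspace_0 empty_iff)
    then show "\<exists>c\<in>K. \<forall>v\<in>K. c \<bullet> v + 1 * norm v \<le> \<sigma> v" using sublinear_zero * by auto
  qed simp
next
  case (Suc k)
  then obtain \<rho> where \<rho>: "\<rho> > 0" and IH: "\<And>(K :: 'a set) \<sigma>. \<lbrakk>subspace K; dim K = k; sublinear L \<sigma>;
    \<forall>v\<in>K. \<epsilon> * norm v \<le> \<sigma> v + \<sigma> (- v)\<rbrakk> \<Longrightarrow> \<exists>c\<in>K. \<forall>v\<in>K. c \<bullet> v + \<rho> * norm v \<le> \<sigma> v"
    by blast
  define \<gamma> where "\<gamma> = min (\<rho> * (\<epsilon> / (4 * L))) (\<epsilon> / 2)"
  have \<gamma>: "0 < \<gamma>" using pos \<rho> by (simp add: \<gamma>_def)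
  show ?case
  proof (intro exI[of _ "\<rho> / (1 + 4 * L / \<gamma> + 2 * \<rho> / \<gamma>)"] conjI allI impI)
    show "0 < \<rho> / (1 + 4 * L / \<gamma> + 2 * \<rho> / \<gamma>)" using pos \<rho> \<gamma> by (simp add: add_pos_pos)
    fix K :: "'a set" and \<sigma> :: "'a \<Rightarrow> real"
    assume *: "subspace K \<and> dim K = Suc k \<and> sublinear L \<sigma> \<and> (\<forall>v\<in>K. \<epsilon> * norm v \<le> \<sigma> v + \<sigma> (- v))"
    then obtain w where w: "w \<in> K" "w \<noteq> 0" by (metis dim_eq_0 nat.distinct(1) singleton_iff subsetI)
    define q where "q = (1 / norm w) *\<^sub>R w"
    have q: "q \<in> K" "norm q = 1" using w * by (auto simp: q_def subspace_scale)
    define H where "H = {v \<in> K. v \<bullet> q = 0}"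
    have "q \<noteq> 0" using q by auto
    have "{y \<in> K. \<forall>x \<in> span {q}. orthogonal x y} = H"
      by (auto simp: H_def orthogonal_def span_singleton inner_commute)
    moreover have "dim {y \<in> K. \<forall>x \<in> span {q}. orthogonal x y} + dim (span {q}) = dim K"
      using * q by (intro dim_subspace_orthogonal_to_vectors) (auto simp: span_minimal)
    moreover have "dim (span {q}) = 1" using \<open>q \<noteq> 0\<close> by (simp add: dim_insert)
    ultimately have "dim H = k" using * by simp
    moreover have "subspace H"
      using * by (auto simp: H_def subspace_def inner_add_left)
    ultimately obtain c1 where "c1 \<in> H" "\<forall>v\<in>H. c1 \<bullet> v + \<rho> * norm v \<le> \<sigma> v"
      using IH[of H \<sigma>] * by (auto simp: H_def)
    then show "\<exists>c\<in>K. \<forall>v\<in>K. c \<bullet> v + \<rho> / (1 + 4 * L / \<gamma> + 2 * \<rho> / \<gamma>) * norm v \<le> \<sigma> v"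
      unfolding \<gamma>_def using * q pos \<rho> by (intro sublinear_margin_step[of L \<sigma> K q \<epsilon> c1 \<rho>]) (auto simp: H_def)
  qed
qed

section \<open>Finite nets independent of the function\<close>

text \<open>Subspaces are classified by the points of a finite net \<open>D\<close> of the unit
  sphere that they come near to. There are at most as many classes as subsets of \<open>D\<close>,
  and one representative of each is kept. A unit vector of the representative is close to a point of
  \<open>D\<close>, which in turn is close to every subspace of the class.\<close>

lemma finite_subspace_net:
  assumes "\<delta> > 0"
  obtains \<K> :: "'a::euclidean_space set set" where "finite \<K>" "\<And>K. K \<in> \<K> \<Longrightarrow> subspace K \<and> dim K = k"
    "\<And>K. \<lbrakk>subspace K; dim K = k\<rbrakk> \<Longrightarrow>
      \<exists>K'\<in>\<K>. \<forall>e\<in>K'. norm e = 1 \<longrightarrow> (\<exists>e'\<in>K. dist e e' < \<delta>)"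
proof -
  have "\<exists>D. finite D \<and> sphere (0::'a) 1 \<subseteq> (\<Union>d\<in>D. ball d (\<delta>/2))"
    using compact_sphere[of "0::'a" 1] assms unfolding compact_eq_totally_bounded by (metis half_gt_zero)
  then obtain D where D: "finite D" "sphere (0::'a) 1 \<subseteq> (\<Union>d\<in>D. ball d (\<delta>/2))" by blast
  define near where "near K = {d \<in> D. \<exists>e\<in>K. dist d e < \<delta>/2}" for K
  define S where "S = {K :: 'a set. subspace K \<and> dim K = k}"
  have "near ` S \<subseteq> Pow D" by (auto simp: near_def)
  then have fin: "finite (near ` S)" using D by (meson finite_Pow_iff finite_subset)
  define \<K> where "\<K> = inv_into S near ` near ` S"
  show thesis
  proof (rule that[of \<K>])
    show "finite \<K>" using fin by (simp add: \<K>_def)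
    show "subspace K \<and> dim K = k" if "K \<in> \<K>" for K
    proof -
      have "K \<in> S" using that unfolding \<K>_def by (auto intro: inv_into_into)
      then show ?thesis by (simp add: S_def)
    qed
    fix K :: "'a set" assume "subspace K" "dim K = k"
    then have KS: "K \<in> S" by (simp add: S_def)
    let ?K' = "inv_into S near (near K)"
    have eq: "near ?K' = near K" using KS by (intro f_inv_into_f) auto
    have "\<exists>e'\<in>K. dist e e' < \<delta>" if "e \<in> ?K'" "norm e = 1" for e
    proof -
      have "e \<in> sphere 0 1" using that by simp
      then obtain d where d: "d \<in> D" "dist d e < \<delta>/2" using D(2) by (auto simp only: UN_iff mem_ball)
      then have "d \<in> near K" using that eq by (auto simp: near_def)
      then obtain e' where e': "e' \<in> K" "dist d e' < \<delta>/2" by (auto simp: near_def)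
      have "dist e e' < \<delta>" using d(2) e'(2) by (metis dist_commute dist_triangle_half_r)
      with e' show ?thesis by blast
    qed
    then show "\<exists>K'\<in>\<K>. \<forall>e\<in>K'. norm e = 1 \<longrightarrow> (\<exists>e'\<in>K. dist e e' < \<delta>)"
      using KS by (auto simp: \<K>_def)
  qed
qed

text \<open>Two discretisations follow each other: \<open>K\<close> is replaced by a member of the
  subspace net, at the cost of half the width, and the centre \<open>c\<close> by a point
  \<open>t\<close> of a finite net, at the cost of half the radius \<open>r\<close>. The nets are
  chosen before \<open>\<sigma>\<close>.\<close>

lemma finite_margin_net:
  assumes pos: "0 < \<epsilon>" "0 < L"
  obtains \<P> :: "('a::euclidean_space set \<times> 'a) set" and \<rho> where "finite \<P>" "\<rho> > 0"
    "\<And>K t. (K, t) \<in> \<P> \<Longrightarrow> subspace K \<and> dim K = k"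
    "\<And>K \<sigma>. \<lbrakk>subspace K; dim K = k; sublinear L \<sigma>;
        \<forall>v\<in>K. norm v = 1 \<longrightarrow> \<epsilon> \<le> \<sigma> v + \<sigma> (- v)\<rbrakk> \<Longrightarrow>
      \<exists>(K', t)\<in>\<P>. \<forall>v\<in>K'. \<forall>s. norm s \<le> \<rho> \<longrightarrow> (t + s) \<bullet> v \<le> \<sigma> v"
proof -
  \<comment> \<open>\<open>\<delta>\<close> makes the total loss of width equal to
    \<open>\<epsilon> / 2\<close>: \<open>\<delta> * \<epsilon>\<close> because \<open>e'\<close>
    only has norm at least \<open>1 - \<delta>\<close>, and \<open>L * \<delta>\<close> for moving
    each of \<open>e'\<close> and \<open>- e'\<close>.\<close>
  define \<delta> where "\<delta> = \<epsilon> / 2 / (\<epsilon> + 2 * L)"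
  have \<delta>: "\<delta> > 0" using pos by (simp add: \<delta>_def)
  have "\<epsilon> + 2 * L \<noteq> 0" using pos by linarith
  then have "\<delta> * (\<epsilon> + 2 * L) = \<epsilon> / 2"
    using nonzero_eq_divide_eq[of "\<epsilon> + 2 * L" \<delta> "\<epsilon> / 2"] \<delta>_def by blast
  then have \<delta>': "\<delta> * \<epsilon> + 2 * (L * \<delta>) = \<epsilon> / 2" by (simp add: algebra_simps)
  obtain \<K> :: "'a set set" where \<K>: "finite \<K>" "\<And>K. K \<in> \<K> \<Longrightarrow> subspace K \<and> dim K = k"
    and near: "\<And>K. \<lbrakk>subspace K; dim K = k\<rbrakk> \<Longrightarrow>
      \<exists>K'\<in>\<K>. \<forall>e\<in>K'. norm e = 1 \<longrightarrow> (\<exists>e'\<in>K. dist e e' < \<delta>)"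
    using finite_subspace_net[OF \<delta>, of k] by metis
  obtain r where r: "r > 0" and margin: "\<And>(K :: 'a set) \<sigma>. \<lbrakk>subspace K; dim K = k; sublinear L \<sigma>;
    \<forall>v\<in>K. (\<epsilon>/2) * norm v \<le> \<sigma> v + \<sigma> (- v)\<rbrakk> \<Longrightarrow> \<exists>c\<in>K. \<forall>v\<in>K. c \<bullet> v + r * norm v \<le> \<sigma> v"
    using sublinear_margin[of "\<epsilon>/2" L k] pos by (metis half_gt_zero)
  have "\<exists>T. finite T \<and> cball (0::'a) L \<subseteq> (\<Union>d\<in>T. ball d (r/2))"
    using compact_cball[of "0::'a" L] r unfolding compact_eq_totally_bounded by (metis half_gt_zero)
  then obtain T where T: "finite T" "cball (0::'a) L \<subseteq> (\<Union>d\<in>T. ball d (r/2))" by blast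
  show thesis
  proof (rule that[of "\<K> \<times> T" "r/2"])
    show "finite (\<K> \<times> T)" "r/2 > 0" using \<K> T r by auto
    show "subspace K \<and> dim K = k" if "(K, t) \<in> \<K> \<times> T" for K t using that \<K> by auto
    fix K :: "'a set" and \<sigma> :: "'a \<Rightarrow> real"
    assume K: "subspace K" "dim K = k" and \<sigma>: "sublinear L \<sigma>"
      and width: "\<forall>v\<in>K. norm v = 1 \<longrightarrow> \<epsilon> \<le> \<sigma> v + \<sigma> (- v)"
    have hom: "\<sigma> (s *\<^sub>R v) = s * \<sigma> v" if "s \<ge> 0" for s v
      using \<sigma> that unfolding sublinear_def by blast
    have scale: "a * norm v \<le> \<sigma> v + \<sigma> (- v)"
      if "subspace V" "v \<in> V" "\<And>v. \<lbrakk>v \<in> V; norm v = 1\<rbrakk> \<Longrightarrow> a \<le> \<sigma> v + \<sigma> (- v)" for V v a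
    proof (cases "v = 0")
      case False
      let ?u = "(1 / norm v) *\<^sub>R v"
      have "a \<le> \<sigma> ?u + \<sigma> (- ?u)" using that False by (intro that(3)) (auto simp: subspace_scale)
      then have "norm v * a \<le> norm v * (\<sigma> ?u + \<sigma> (- ?u))" by (intro mult_left_mono) auto
      also have "\<dots> = \<sigma> (norm v *\<^sub>R ?u) + \<sigma> (norm v *\<^sub>R (- ?u))" by (simp only: hom[OF norm_ge_zero] distrib_left)
      finally show ?thesis using False by (simp add: mult.commute)
    qed (use sublinear_zero[OF \<sigma>] in simp)
    obtain K' where K': "K' \<in> \<K>" "\<And>e. \<lbrakk>e \<in> K'; norm e = 1\<rbrakk> \<Longrightarrow> \<exists>e'\<in>K. dist e e' < \<delta>"
      using near[OF K] by blast
    have sK': "subspace K'" "dim K' = k" using \<K> K' by auto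
    have "\<epsilon>/2 \<le> \<sigma> e + \<sigma> (- e)" if e: "e \<in> K'" "norm e = 1" for e
    proof -
      obtain e' where e': "e' \<in> K" "norm (e' - e) < \<delta>"
        using K'(2)[OF e] by (metis dist_norm norm_minus_commute)
      have "L * norm (e' - e) \<le> L * \<delta>" using e' pos by (intro mult_left_mono) auto
      moreover have "\<sigma> e' - L * norm (e' - e) \<le> \<sigma> e" by (rule sublinear_lipschitz[OF \<sigma>])
      moreover have "\<sigma> (- e') - L * norm (e' - e) \<le> \<sigma> (- e)"
        using sublinear_lipschitz[OF \<sigma>, of "- e'" "- e"] by (simp add: norm_minus_commute)
      moreover have "\<epsilon> * norm e' \<le> \<sigma> e' + \<sigma> (- e')" using scale[OF K(1) e'(1)] width by blast
      moreover have "1 - \<delta> \<le> norm e'"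
        using norm_triangle_ineq2[of e "e - e'"] e' e by (simp add: norm_minus_commute)
      then have "\<epsilon> * (1 - \<delta>) \<le> \<epsilon> * norm e'" using pos by (intro mult_left_mono) auto
      then have "\<epsilon> - \<delta> * \<epsilon> \<le> \<epsilon> * norm e'" by (simp add: algebra_simps)
      ultimately show ?thesis using \<delta>' by linarith
    qed
    then have "\<forall>v\<in>K'. (\<epsilon>/2) * norm v \<le> \<sigma> v + \<sigma> (- v)" using scale[OF sK'(1)] by blast
    then obtain c where c: "c \<in> K'" "\<And>v. v \<in> K' \<Longrightarrow> c \<bullet> v + r * norm v \<le> \<sigma> v"
      using margin[OF sK' \<sigma>] by blast
    \<comment> \<open>This places \<open>c\<close> in \<open>cball 0 L\<close>, the ball that
      \<open>T\<close> was chosen to cover.\<close>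
    have "c \<bullet> c \<le> \<sigma> c" using c(2)[OF c(1)] r by (smt (verit) mult_nonneg_nonneg norm_ge_zero)
    then have "norm c \<le> L" using norm_le_of_dominated[OF \<sigma>] pos by simp
    then obtain t where t: "t \<in> T" "norm (t - c) < r/2"
      using T(2) by (force simp: dist_norm)
    have "(t + s) \<bullet> v \<le> \<sigma> v" if v: "v \<in> K'" and s: "norm s \<le> r/2" for v s
    proof -
      have "(t + s) \<bullet> v = c \<bullet> v + (t - c + s) \<bullet> v" by (simp add: algebra_simps)
      also have "(t - c + s) \<bullet> v \<le> norm (t - c + s) * norm v" by (rule norm_cauchy_schwarz)
      also have "norm (t - c + s) * norm v \<le> r * norm v"
        using norm_triangle_ineq[of "t - c" s] t s by (intro mult_right_mono) auto
      finally show ?thesis using c(2)[OF v] by linarith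
    qed
    then show "\<exists>(K', t)\<in>\<K> \<times> T. \<forall>v\<in>K'. \<forall>s. norm s \<le> r/2 \<longrightarrow> (t + s) \<bullet> v \<le> \<sigma> v"
      using K' t by blast
  qed
qed

section \<open>DC surfaces\<close>

lemma DC_on_cmult:
  assumes "DC_on C F"
  shows "DC_on C (\<lambda>x. c * F x)"
proof -
  obtain g h where gh: "convex_on C g" "continuous_on C g" "convex_on C h" "continuous_on C h"
    "\<And>x. x \<in> C \<Longrightarrow> F x = g x - h x"
    using assms unfolding DC_on_def by blast
  show ?thesis
  proof (cases "0 \<le> c")
    case True
    then show ?thesis
      unfolding DC_on_def using gh
      by (intro exI[of _ "\<lambda>x. c * g x"] exI[of _ "\<lambda>x. c * h x"])
        (auto intro!: convex_on_cmul continuous_intros simp: right_diff_distrib)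
  next
    case False
    then show ?thesis
      unfolding DC_on_def using gh
      by (intro exI[of _ "\<lambda>x. (-c) * h x"] exI[of _ "\<lambda>x. (-c) * g x"] conjI convex_on_cmul)
        (auto intro!: continuous_intros simp: right_diff_distrib)
  qed
qed

lemma DC_on_add:
  assumes "DC_on C F" "DC_on C G"
  shows "DC_on C (\<lambda>x. F x + G x)"
proof -
  obtain g h where gh: "convex_on C g" "continuous_on C g" "convex_on C h" "continuous_on C h"
    "\<And>x. x \<in> C \<Longrightarrow> F x = g x - h x"
    using assms(1) unfolding DC_on_def by blast
  obtain g' h' where gh': "convex_on C g'" "continuous_on C g'" "convex_on C h'" "continuous_on C h'"
    "\<And>x. x \<in> C \<Longrightarrow> G x = g' x - h' x"
    using assms(2) unfolding DC_on_def by blast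
  show ?thesis
    unfolding DC_on_def using gh gh'
    by (intro exI[of _ "\<lambda>x. g x + g' x"] exI[of _ "\<lambda>x. h x + h' x"])
      (auto intro!: continuous_intros)
qed

lemma DC_on_sum:
  assumes "convex C" "finite I" "\<And>i. i \<in> I \<Longrightarrow> DC_on C (F i)"
  shows "DC_on C (\<lambda>x. \<Sum>i\<in>I. F i x)"
  using assms(2,3)
proof (induction I rule: finite_induct)
  case empty
  have "convex_on C (\<lambda>x. 0)" using assms(1) by (simp add: convex_on_def)
  then show ?case
    unfolding DC_on_def by (intro exI[of _ "\<lambda>x. 0"]) auto
qed (simp add: DC_on_add)

lemma lipschitz_on_sum:
  fixes f :: "'i \<Rightarrow> 'a::metric_space \<Rightarrow> 'b::real_normed_vector"
  assumes "\<And>i. i \<in> I \<Longrightarrow> \<exists>C. C-lipschitz_on U (f i)"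
  shows "\<exists>C. C-lipschitz_on U (\<lambda>x. \<Sum>i\<in>I. f i x)"
proof (cases "finite I")
  case True
  then show ?thesis using assms
  proof (induction I rule: finite_induct)
    case empty
    then show ?case by (auto intro: lipschitz_on_constant)
  next
    case (insert i I)
    then obtain C D where "C-lipschitz_on U (f i)" "D-lipschitz_on U (\<lambda>x. \<Sum>i\<in>I. f i x)" by blast
    with insert show ?case by (auto dest: lipschitz_on_add)
  qed
qed (auto intro: lipschitz_on_constant)

lemma dim_orthogonal_comp:
  fixes K :: "'a::euclidean_space set"
  assumes "subspace K"
  shows "dim (K\<^sup>\<bottom>) = DIM('a) - dim K"
proof -
  have "dim {y \<in> UNIV. \<forall>x\<in>K. orthogonal x y} + dim K = dim (UNIV :: 'a set)"
    using assms by (intro dim_subspace_orthogonal_to_vectors) auto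
  then show ?thesis by (simp add: orthogonal_comp_def)
qed

text \<open>At a point \<open>x = w + z\<close> of the covered set, with \<open>w \<in> K\<^sup>\<bottom>\<close> and \<open>z \<in> K\<close>, the partial
  minimum \<open>g p w\<close> of \<open>F (w + \<kappa>) - p \<bullet> \<kappa>\<close> over \<open>\<kappa> \<in> K\<close> is attained at \<open>\<kappa> = z\<close> for all
  \<open>p \<in> cball t \<rho>\<close>. Hence \<open>g t w - g (t + \<rho> b) w = \<rho> (b \<bullet> z)\<close>, which expresses \<open>z\<close> through differences
  of convex functions of \<open>w\<close>.\<close>

lemma margin_set_subset_DC_surface:
  fixes F :: "'a::euclidean_space \<Rightarrow> real"
  assumes conv: "convex_on UNIV F" and lip: "L-lipschitz_on UNIV F"
    and K: "subspace K" "1 \<le> dim K" "dim K < DIM('a)" and \<rho>: "\<rho> > 0"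
  shows "\<exists>S. DC_surface (DIM('a) - dim K) S \<and>
    {x. \<forall>v\<in>K. \<forall>s. norm s \<le> \<rho> \<longrightarrow> F x + (t + s) \<bullet> v \<le> F (x + v)} \<subseteq> S"
proof -
  define M where "M = {x. \<forall>v\<in>K. \<forall>s. norm s \<le> \<rho> \<longrightarrow> F x + (t + s) \<bullet> v \<le> F (x + v)}"
  have M: "F x + (t + s) \<bullet> v \<le> F (x + v)" if "x \<in> M" "v \<in> K" "norm s \<le> \<rho>" for x v s
    using that by (simp add: M_def)
  define g where "g p w = (INF \<kappa>\<in>K. F (w + \<kappa>) - p \<bullet> \<kappa>)" for p w
  obtain B where B: "B \<subseteq> K" "pairwise orthogonal B" "\<And>b. b \<in> B \<Longrightarrow> norm b = 1"
      "independent B" "card B = dim K" "span B = K"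
    using orthonormal_basis_subspace[OF K(1)] by metis
  have finB: "finite B" using B(4) by (rule independent_imp_finite)
  \<comment> \<open>If \<open>M\<close> is empty, the infima defining \<open>g\<close> may be over
    sets unbounded below and carry no information; the zero map still yields a DC surface.\<close>
  define \<phi> where
    "\<phi> = (if M = {} then (\<lambda>w. 0) else (\<lambda>w. \<Sum>b\<in>B. ((g t w - g (t + \<rho> *\<^sub>R b) w) / \<rho>) *\<^sub>R b))"
  let ?W = "K\<^sup>\<bottom>"
  have W: "subspace ?W" by (rule subspace_orthogonal_comp)
  have L: "0 \<le> L" using lip by (rule lipschitz_on_nonneg)
  have Fle: "F y \<le> F y' + L * dist y y'" for y y'
    using lipschitz_onD[OF lip, of y y'] by (simp add: dist_real_def abs_le_iff)
  \<comment> \<open>A single point \<open>x0\<close> of \<open>M\<close> bounds the infimum at every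
    \<open>w\<close>: moving from \<open>x0\<close> to \<open>w\<close> changes \<open>F\<close> by
    at most \<open>L * dist x0 w\<close>, uniformly in \<open>\<kappa>\<close>.\<close>
  have bdd: "bdd_below ((\<lambda>\<kappa>. F (w + \<kappa>) - p \<bullet> \<kappa>) ` K)"
    if x0: "x0 \<in> M" and p: "norm (p - t) \<le> \<rho>" for w p x0
  proof (rule bdd_belowI2)
    fix \<kappa> assume \<kappa>: "\<kappa> \<in> K"
    have "F x0 + (t + (p - t)) \<bullet> \<kappa> \<le> F (x0 + \<kappa>)" using M[OF x0 \<kappa> p] .
    moreover have "F (x0 + \<kappa>) \<le> F (w + \<kappa>) + L * dist x0 w"
      using Fle[of "x0 + \<kappa>" "w + \<kappa>"] by simp
    ultimately show "F x0 - L * dist x0 w \<le> F (w + \<kappa>) - p \<bullet> \<kappa>" by simp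
  qed
  have g: "convex_on UNIV (g p)" "L-lipschitz_on UNIV (g p)"
    if x0: "M \<noteq> {}" and p: "norm (p - t) \<le> \<rho>" for p
  proof -
    have K0: "convex K" "K \<noteq> {}" using K by (auto simp: subspace_imp_convex subspace_0)
    obtain y where "y \<in> M" using x0 by blast
    note bdd' = bdd[OF this p]
    have joint: "F (u *\<^sub>R y + v *\<^sub>R y' + (u *\<^sub>R z + v *\<^sub>R z')) - p \<bullet> (u *\<^sub>R z + v *\<^sub>R z')
        \<le> u * (F (y + z) - p \<bullet> z) + v * (F (y' + z') - p \<bullet> z')"
      if "0 \<le> u" "0 \<le> v" "u + v = 1" for u v y y' z z'
    proof -
      have "F (u *\<^sub>R (y + z) + v *\<^sub>R (y' + z')) \<le> u * F (y + z) + v * F (y' + z')"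
        using conv that by (simp add: convex_on_def)
      then show ?thesis by (simp add: algebra_simps)
    qed
    have lp: "F (y + z) - p \<bullet> z \<le> F (y' + z) - p \<bullet> z + L * dist y y'" for y y' z
      using Fle[of "y + z" "y' + z"] by simp
    show "convex_on UNIV (g p)" "L-lipschitz_on UNIV (g p)"
      unfolding g_def[abs_def]
      by (rule INF_jointly_convex_lipschitz[where G = "\<lambda>w \<kappa>. F (w + \<kappa>) - p \<bullet> \<kappa>", OF K0 L bdd' joint lp];
          assumption)+
  qed
  have near: "norm (t - t) \<le> \<rho>" "\<And>b. b \<in> B \<Longrightarrow> norm (t + \<rho> *\<^sub>R b - t) \<le> \<rho>"
    using \<rho> B by auto
  have "\<phi> w \<in> K" for w
    using B K by (auto simp: \<phi>_def intro!: subspace_sum subspace_scale subspace_0)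
  then have range: "\<phi> ` ?W \<subseteq> ?W\<^sup>\<bottom>" using orthogonal_comp_self[OF K(1)] by auto
  have "\<exists>C. C-lipschitz_on ?W \<phi>"
  proof (cases "M = {}")
    case True
    then show ?thesis by (auto simp: \<phi>_def intro: lipschitz_on_constant)
  next
    case False
    have "\<exists>C. C-lipschitz_on ?W (\<lambda>w. ((g t w - g (t + \<rho> *\<^sub>R b) w) / \<rho>) *\<^sub>R b)" if b: "b \<in> B" for b
    proof -
      have "(L + L)-lipschitz_on ?W (\<lambda>w. g t w - g (t + \<rho> *\<^sub>R b) w)"
        using g(2)[OF False near(1)] g(2)[OF False near(2)[OF b]]
        by (intro lipschitz_on_diff) (auto intro: lipschitz_on_subset)
      then have "(1/\<rho> * (L + L))-lipschitz_on ?W (\<lambda>w. 1/\<rho> * (g t w - g (t + \<rho> *\<^sub>R b) w))"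
        using \<rho> by (intro lipschitz_on_cmult_real_nonneg) auto
      then have *: "(1/\<rho> * (L + L))-lipschitz_on ?W (\<lambda>w. (g t w - g (t + \<rho> *\<^sub>R b) w) / \<rho>)" by simp
      show ?thesis
      proof (intro exI lipschitz_onI)
        fix x y assume "x \<in> ?W" "y \<in> ?W"
        then show "dist (((g t x - g (t + \<rho> *\<^sub>R b) x) / \<rho>) *\<^sub>R b) (((g t y - g (t + \<rho> *\<^sub>R b) y) / \<rho>) *\<^sub>R b)
            \<le> (1/\<rho> * (L + L)) * dist x y"
          using lipschitz_onD[OF *, of x y] B(3)[OF b]
          by (simp add: dist_norm flip: scaleR_diff_left)
      qed (use \<rho> L in auto)
    qed
    then show ?thesis using False by (simp add: \<phi>_def lipschitz_on_sum)
  qed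
  moreover have "DC_map_on ?W \<phi>"
    unfolding DC_map_on_def
  proof (intro allI impI)
    fix l :: "'a \<Rightarrow> real" assume l: "linear l"
    have convW: "convex ?W" using W by (rule subspace_imp_convex)
    show "DC_on ?W (l \<circ> \<phi>)"
    proof (cases "M = {}")
      case True
      then show ?thesis
        using DC_on_sum[OF convW, of "{}"] l by (simp add: \<phi>_def o_def linear_0)
    next
      case False
      have "DC_on ?W (\<lambda>w. \<Sum>b\<in>B. (l b / \<rho>) * (g t w - g (t + \<rho> *\<^sub>R b) w))"
      proof (intro DC_on_sum[OF convW finB] DC_on_cmult)
        fix b assume b: "b \<in> B"
        have 1: "convex_on ?W (g p)" "continuous_on ?W (g p)" if "norm (p - t) \<le> \<rho>" for p
          using convex_on_subset[OF g(1)[OF False that] _ convW]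
            lipschitz_on_continuous_on[OF lipschitz_on_subset[OF g(2)[OF False that]]] by auto
        show "DC_on ?W (\<lambda>w. g t w - g (t + \<rho> *\<^sub>R b) w)"
          unfolding DC_on_def using 1[OF near(1)] 1[OF near(2)[OF b]] by blast
      qed
      moreover have "l \<circ> \<phi> = (\<lambda>w. \<Sum>b\<in>B. (l b / \<rho>) * (g t w - g (t + \<rho> *\<^sub>R b) w))"
        using False l by (simp add: \<phi>_def fun_eq_iff linear_sum linear_scale mult.commute)
      ultimately show ?thesis by simp
    qed
  qed
  ultimately have "DC_surface (DIM('a) - dim K) {w + \<phi> w |w. w \<in> ?W}"
    unfolding DC_surface_def using K W range dim_orthogonal_comp[OF K(1)]
    by (intro conjI exI[of _ ?W] exI[of _ \<phi>]) auto
  moreover have "M \<subseteq> {w + \<phi> w |w. w \<in> ?W}"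
  proof
    fix x assume x: "x \<in> M"
    then have ne: "M \<noteq> {}" by blast
    have "x \<in> K + ?W" using subspace_sum_orthogonal_comp[OF K(1)] by simp
    then obtain z w where zw: "x = z + w" "z \<in> K" "w \<in> ?W" by (auto simp: set_plus_def)
    have val: "g p w = F x - p \<bullet> z" if p: "norm (p - t) \<le> \<rho>" for p
    proof (rule antisym)
      show "g p w \<le> F x - p \<bullet> z"
        unfolding g_def using cINF_lower[OF bdd[OF x p] zw(2), of w] zw by (simp add: add.commute)
      show "F x - p \<bullet> z \<le> g p w"
        unfolding g_def
      proof (rule cINF_greatest)
        fix \<kappa> assume "\<kappa> \<in> K"
        \<comment> \<open>The minimality that defines \<open>M\<close>, used with the increment
          \<open>\<kappa> - z\<close>, compares the value at \<open>z\<close> with that at any other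
          \<open>\<kappa>\<close>.\<close>
        then have "\<kappa> - z \<in> K" using K zw by (simp add: subspace_diff)
        then have "F x + (t + (p - t)) \<bullet> (\<kappa> - z) \<le> F (x + (\<kappa> - z))" by (rule M[OF x _ p])
        then show "F x - p \<bullet> z \<le> F (w + \<kappa>) - p \<bullet> \<kappa>"
          using zw by (simp add: inner_diff_right add.commute)
      qed (use K in \<open>auto simp: subspace_0\<close>)
    qed
    have "(g t w - g (t + \<rho> *\<^sub>R b) w) / \<rho> = z \<bullet> b" if "b \<in> B" for b
      using val[OF near(1)] val[OF near(2)[OF that]] \<rho> by (simp add: inner_add_left inner_commute[of z b])
    then have "\<phi> w = (\<Sum>b\<in>B. (z \<bullet> b) *\<^sub>R b)" using ne by (simp add: \<phi>_def)
    also have "\<dots> = z" using B zw finB by (intro orthonormal_basis_expand) auto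
    finally have "x = w + \<phi> w" using zw by (simp add: add.commute)
    then show "x \<in> {w + \<phi> w |w. w \<in> ?W}" using zw by blast
  qed
  ultimately show ?thesis unfolding M_def by blast
qed

section \<open>The covering in a fixed space\<close>

lemma DC_coverable_subset: "DC_coverable j N B \<Longrightarrow> A \<subseteq> B \<Longrightarrow> DC_coverable j N A"
  unfolding DC_coverable_def by (meson order_trans)

text \<open>\<open>N\<close> is the number of pairs in the margin net, obtained before
  \<open>\<Omega>\<close> and \<open>f\<close> enter. Each pair contributes one surface.\<close>

lemma ex_uniform_DC_bound:
  assumes "1 \<le> k" "k < DIM('a::euclidean_space)" "\<epsilon> > 0" "L > 0"
  shows "\<exists>N. uniform_DC_bound TYPE('a) k L \<epsilon> N"
proof -
  obtain \<P> :: "('a set \<times> 'a) set" and \<rho> where \<P>: "finite \<P>" and \<rho>: "\<rho> > 0"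
    and dim: "\<And>K t. (K, t) \<in> \<P> \<Longrightarrow> subspace K \<and> dim K = k"
    and net: "\<And>K \<sigma>. \<lbrakk>subspace K; dim K = k; sublinear L \<sigma>;
        \<forall>v\<in>K. norm v = 1 \<longrightarrow> \<epsilon> \<le> \<sigma> v + \<sigma> (- v)\<rbrakk> \<Longrightarrow>
      \<exists>(K', t)\<in>\<P>. \<forall>v\<in>K'. \<forall>s. norm s \<le> \<rho> \<longrightarrow> (t + s) \<bullet> v \<le> \<sigma> v"
    by (rule finite_margin_net[OF assms(3,4), where k = k]) blast
  have Z: "DC_coverable (DIM('a) - k) (card \<P>) (Z_set k \<epsilon> \<Omega> f)"
    if \<Omega>: "open \<Omega>" and f: "L-lipschitz_on \<Omega> f" "convex_on \<Omega> f" for \<Omega> :: "'a set" and f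
  proof (cases "\<Omega> = {}")
    case True
    then show ?thesis unfolding DC_coverable_def by (intro exI[of _ "{}"]) (auto simp: Z_set_def)
  next
    case False
    obtain F where F: "convex_on UNIV F" "L-lipschitz_on UNIV F" and eq: "\<And>x. x \<in> \<Omega> \<Longrightarrow> F x = f x"
      using convex_lipschitz_extension[OF f(2,1) False] by metis
    define M where "M = (\<lambda>(K, t). {x. \<forall>v\<in>K. \<forall>s. norm s \<le> \<rho> \<longrightarrow> F x + (t + s) \<bullet> v \<le> F (x + v)})"
    have "\<exists>S. DC_surface (DIM('a) - k) S \<and> M P \<subseteq> S" if "P \<in> \<P>" for P
    proof -
      obtain K t where P: "P = (K, t)" by (cases P)
      then have "subspace K" "dim K = k" using dim that by auto
      then show ?thesis
        using margin_set_subset_DC_surface[OF F, of K \<rho> t] assms \<rho> by (simp add: M_def P)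
    qed
    then obtain S where S: "\<And>P. P \<in> \<P> \<Longrightarrow> DC_surface (DIM('a) - k) (S P) \<and> M P \<subseteq> S P" by metis
    have "Z_set k \<epsilon> \<Omega> f \<subseteq> \<Union>(S ` \<P>)"
    proof
      fix x assume "x \<in> Z_set k \<epsilon> \<Omega> f"
      then obtain K where x: "x \<in> \<Omega>" and K: "subspace K" "dim K = k"
        and width: "\<And>v. \<lbrakk>v \<in> K; norm v = 1\<rbrakk> \<Longrightarrow> right_dir_deriv f x v + right_dir_deriv f x (- v) > \<epsilon>"
        by (auto simp: Z_set_def)
      let ?\<sigma> = "right_dir_deriv F x"
      have "?\<sigma> v = right_dir_deriv f x v" for v
        using right_dir_deriv_eq_of_eq_on_open[OF \<Omega> x eq] by simp
      then have "\<epsilon> \<le> ?\<sigma> v + ?\<sigma> (- v)" if "v \<in> K" "norm v = 1" for v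
        using width[OF that] by simp
      moreover have "sublinear L ?\<sigma>"
        unfolding sublinear_def using right_dir_deriv_convex(3-5)[OF F] by blast
      ultimately obtain K' t where P: "(K', t) \<in> \<P>"
        and le: "\<And>v s. \<lbrakk>v \<in> K'; norm s \<le> \<rho>\<rbrakk> \<Longrightarrow> (t + s) \<bullet> v \<le> ?\<sigma> v"
        using net[OF K, of ?\<sigma>] by fast
      \<comment> \<open>The derivative is at most the difference quotient at step 1, so domination
        of the derivative becomes an inequality for the full increment \<open>v\<close>. Here
        \<open>x + v\<close> may leave \<open>\<Omega>\<close>, which is why \<open>F\<close>
        replaces \<open>f\<close>.\<close>
      have "F x + (t + s) \<bullet> v \<le> F (x + v)" if "v \<in> K'" "norm s \<le> \<rho>" for v s
        using le[OF that] right_dir_deriv_convex(2)[OF F, of 1 x v] by simp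
      then have "x \<in> M (K', t)" by (simp add: M_def)
      then show "x \<in> \<Union>(S ` \<P>)" using S[OF P] P by blast
    qed
    then show ?thesis
      unfolding DC_coverable_def using S \<P>
      by (intro exI[of _ "S ` \<P>"]) (auto intro: card_image_le)
  qed
  show ?thesis
    unfolding uniform_DC_bound_def
    using Z DC_coverable_subset[OF Z Sigma_set_subset_Z_set] assms(3)
    by (intro exI[of _ "card \<P>"]) blast
qed

section \<open>Isometric invariance\<close>

text \<open>Both directions are parameters, so that the swapped pair is again an instance and each
  fact is available in either direction.\<close>

locale linear_isometry_pair =
  fixes h :: "'b::euclidean_space \<Rightarrow> 'a::euclidean_space" and h' :: "'a \<Rightarrow> 'b"
  assumes lin: "linear h" "linear h'"
    and nrm: "norm (h x) = norm x" "norm (h' y) = norm y"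
    and inv [simp]: "h' (h x) = x" "h (h' y) = y"
begin

lemma add: "h (x + y) = h x + h y" "h' (u + v) = h' u + h' v"
  and diff: "h (x - y) = h x - h y" "h' (u - v) = h' u - h' v"
  and minus: "h (- x) = - h x"
  and scale: "h (t *\<^sub>R x) = t *\<^sub>R h x" "h' (t *\<^sub>R u) = t *\<^sub>R h' u"
  using lin by (simp_all add: linear_add linear_diff linear_neg linear_scale)

lemma dist_eq: "dist (h x) (h y) = dist x y" "dist (h' u) (h' v) = dist u v"
  by (simp_all add: dist_norm nrm flip: diff)

lemma inner_eq: "h x \<bullet> h y = x \<bullet> y" "h' u \<bullet> h' v = u \<bullet> v"
  by (simp_all add: dot_norm nrm flip: add)

lemma inj: "inj h" "inj h'"
  using inv by (metis injI)+

lemma right_dir_deriv_comp: "right_dir_deriv (f \<circ> h') (h x) (h v) = right_dir_deriv f x v"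
  by (simp add: right_dir_deriv_def add scale)

text \<open>One inclusion is enough here: it is what pulling back a covering through
  \<open>DC_coverable_preimage\<close> requires.\<close>

lemma image_Z_set_subset: "h ` Z_set k \<epsilon> \<Omega> f \<subseteq> Z_set k \<epsilon> (h ` \<Omega>) (f \<circ> h')"
proof
  fix y assume "y \<in> h ` Z_set k \<epsilon> \<Omega> f"
  then obtain x K where y: "y = h x" and x: "x \<in> \<Omega>" and K: "subspace K" "dim K = k"
    and width: "\<And>v. \<lbrakk>v \<in> K; norm v = 1\<rbrakk> \<Longrightarrow> right_dir_deriv f x v + right_dir_deriv f x (- v) > \<epsilon>"
    by (auto simp: Z_set_def)
  have "subspace (h ` K)" "dim (h ` K) = k"
    using K lin inj dim_image_eq[of h K] by (auto simp: linear_subspace_image inj_on_def)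
  moreover have "right_dir_deriv (f \<circ> h') y v + right_dir_deriv (f \<circ> h') y (- v) > \<epsilon>"
    if "v \<in> h ` K" "norm v = 1" for v
    using that width by (auto simp: y right_dir_deriv_comp nrm simp flip: minus)
  ultimately show "y \<in> Z_set k \<epsilon> (h ` \<Omega>) (f \<circ> h')"
    unfolding Z_set_def y using x by blast
qed

lemma image_subdifferential_subset:
  "h ` subdifferential \<Omega> f x \<subseteq> subdifferential (h ` \<Omega>) (f \<circ> h') (h x)"
  by (auto simp: subdifferential_def inner_eq simp flip: diff)

lemma image_Sigma_set_subset: "h ` Sigma_set k \<epsilon> \<Omega> f \<subseteq> Sigma_set k \<epsilon> (h ` \<Omega>) (f \<circ> h')"
proof
  fix y assume "y \<in> h ` Sigma_set k \<epsilon> \<Omega> f"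
  then obtain x A c where y: "y = h x" and x: "x \<in> \<Omega>" and A: "affine A" "aff_dim A = int k" "c \<in> A"
    and sub: "ball c \<epsilon> \<inter> A \<subseteq> subdifferential \<Omega> f x"
    by (auto simp: Sigma_set_def)
  have "affine (h ` A)"
    using A(1) lin(1) affine_hull_linear_image[of h A] by (metis affine_hull_eq linear_conv_bounded_linear)
  moreover have "aff_dim (h ` A) = int k"
    using A lin inj by (simp add: aff_dim_injective_linear_image)
  moreover have "ball (h c) \<epsilon> \<inter> h ` A = h ` (ball c \<epsilon> \<inter> A)"
    by (auto simp: dist_eq)
  then have "ball (h c) \<epsilon> \<inter> h ` A \<subseteq> subdifferential (h ` \<Omega>) (f \<circ> h') y"
    unfolding y using sub image_subdifferential_subset by blast
  ultimately show "y \<in> Sigma_set k \<epsilon> (h ` \<Omega>) (f \<circ> h')"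
    unfolding Sigma_set_def y using x A(3) by blast
qed

lemma convex_on_comp:
  assumes "convex_on C g" shows "convex_on (h' ` C) (g \<circ> h)"
  unfolding convex_on_def
proof (intro conjI ballI allI impI)
  show "convex (h' ` C)" using assms lin by (auto simp: convex_on_def convex_linear_image)
  fix x y and u v :: real assume "x \<in> h' ` C" "y \<in> h' ` C" "0 \<le> u" "0 \<le> v" "u + v = 1"
  then show "(g \<circ> h) (u *\<^sub>R x + v *\<^sub>R y) \<le> u * (g \<circ> h) x + v * (g \<circ> h) y"
    using assms by (auto simp: convex_on_def add scale)
qed

lemma DC_on_comp:
  assumes "DC_on C F" shows "DC_on (h' ` C) (F \<circ> h)"
proof -
  obtain g k where gk: "convex_on C g" "continuous_on C g" "convex_on C k" "continuous_on C k"
    "\<And>x. x \<in> C \<Longrightarrow> F x = g x - k x"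
    using assms unfolding DC_on_def by blast
  have "continuous_on (h' ` C) (g \<circ> h)" if "continuous_on C g" for g :: "'a \<Rightarrow> real"
    using that lin linear_continuous_on
    by (intro continuous_on_compose) (auto simp: image_image linear_conv_bounded_linear)
  then show ?thesis
    unfolding DC_on_def using gk
    by (intro exI[of _ "g \<circ> h"] exI[of _ "k \<circ> h"]) (auto intro: convex_on_comp)
qed

lemma DC_surface_image:
  assumes "DC_surface j S" shows "DC_surface j (h' ` S)"
proof -
  obtain W \<phi> C where j: "0 < j" "j < DIM('a)" and W: "subspace W" "dim W = j"
    and \<phi>: "\<phi> ` W \<subseteq> W\<^sup>\<bottom>" "C-lipschitz_on W \<phi>" "DC_map_on W \<phi>" and S: "S = {w + \<phi> w |w. w \<in> W}"
    using assms unfolding DC_surface_def by blast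
  have "DIM('a) = DIM('b)"
    using dim_image_eq[of h' UNIV] lin inj inv by (simp add: surjI[of h' h])
  moreover have "subspace (h' ` W)" "dim (h' ` W) = j"
    using W lin inj dim_image_eq[of h' W] by (auto simp: linear_subspace_image inj_on_def)
  moreover have "(h' \<circ> \<phi> \<circ> h) ` (h' ` W) \<subseteq> (h' ` W)\<^sup>\<bottom>"
    using \<phi>(1) by (auto simp: orthogonal_comp_def orthogonal_def inner_eq)
  moreover have "C-lipschitz_on (h' ` W) (h' \<circ> \<phi> \<circ> h)"
    using \<phi>(2) by (auto simp: lipschitz_on_def dist_eq)
  moreover have "DC_map_on (h' ` W) (h' \<circ> \<phi> \<circ> h)"
    unfolding DC_map_on_def
  proof (intro allI impI)
    fix l :: "'b \<Rightarrow> real" assume "linear l"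
    then have "DC_on W ((l \<circ> h') \<circ> \<phi>)"
      using \<phi>(3) linear_compose[OF lin(2)] unfolding DC_map_on_def by blast
    then show "DC_on (h' ` W) (l \<circ> (h' \<circ> \<phi> \<circ> h))"
      using DC_on_comp[of W "(l \<circ> h') \<circ> \<phi>"] by (simp add: comp_assoc)
  qed
  moreover have "h' ` S = {w + (h' \<circ> \<phi> \<circ> h) w |w. w \<in> h' ` W}"
    unfolding S Setcompr_eq_image by (simp add: image_image add)
  ultimately show ?thesis
    unfolding DC_surface_def using j
    by (intro conjI exI[of _ "h' ` W"] exI[of _ "h' \<circ> \<phi> \<circ> h"] exI[of _ C]) simp_all
qed

text \<open>The surfaces covering the image are carried back by \<open>h'\<close>; taking images of
  the members cannot enlarge the family.\<close>

lemma DC_coverable_preimage: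
  assumes "DC_coverable j N A" "h ` B \<subseteq> A"
  shows "DC_coverable j N B"
proof -
  obtain \<S> where \<S>: "finite \<S>" "card \<S> \<le> N" "\<And>S. S \<in> \<S> \<Longrightarrow> DC_surface j S" "A \<subseteq> \<Union>\<S>"
    using assms(1) unfolding DC_coverable_def by blast
  have "B \<subseteq> \<Union>((`) h' ` \<S>)"
  proof
    fix x assume "x \<in> B"
    then obtain S where "S \<in> \<S>" "h x \<in> S" using assms(2) \<S>(4) by blast
    then show "x \<in> \<Union>((`) h' ` \<S>)" by (metis UN_I image_eqI inv(1))
  qed
  moreover have "card ((`) h' ` \<S>) \<le> N" using card_image_le[OF \<S>(1), of "(`) h'"] \<S>(2) by linarith
  ultimately show ?thesis
    unfolding DC_coverable_def using \<S>(1,3) DC_surface_image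
    by (intro exI[of _ "(`) h' ` \<S>"]) auto
qed

lemma uniform_DC_bound_transfer:
  assumes "uniform_DC_bound TYPE('a) k L \<epsilon> N" "DIM('a) = DIM('b)"
  shows "uniform_DC_bound TYPE('b) k L \<epsilon> N"
  unfolding uniform_DC_bound_def
proof (intro allI impI)
  fix \<Omega> :: "'b set" and f
  assume *: "open \<Omega> \<and> convex \<Omega> \<and> L-lipschitz_on \<Omega> f \<and> convex_on \<Omega> f"
  \<comment> \<open>\<open>convex_on_comp\<close> moves functions from \<open>'a\<close> to
    \<open>'b\<close>; the swapped instance moves \<open>f\<close> the other way.\<close>
  interpret inverse: linear_isometry_pair h' h
    by (rule linear_isometry_pair.intro) (simp_all add: lin nrm)
  have "open (h ` \<Omega>)" using * lin inj inv by (metis open_surjective_linear_image surjI)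
  moreover have "convex (h ` \<Omega>)" using * lin by (simp add: convex_linear_image)
  moreover have "L-lipschitz_on (h ` \<Omega>) (f \<circ> h')" using * by (auto simp: lipschitz_on_def dist_eq)
  moreover have "convex_on (h ` \<Omega>) (f \<circ> h')" using * inverse.convex_on_comp by blast
  ultimately have "DC_coverable (DIM('a) - k) N (Sigma_set k \<epsilon> (h ` \<Omega>) (f \<circ> h'))"
    "DC_coverable (DIM('a) - k) N (Z_set k \<epsilon> (h ` \<Omega>) (f \<circ> h'))"
    using assms(1) unfolding uniform_DC_bound_def by blast+
  then show "DC_coverable (DIM('b) - k) N (Sigma_set k \<epsilon> \<Omega> f) \<and>
      DC_coverable (DIM('b) - k) N (Z_set k \<epsilon> \<Omega> f)"
    using DC_coverable_preimage image_Sigma_set_subset image_Z_set_subset assms(2) by metis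
qed

end

theorem proposition4p4:
  fixes d k :: nat and L \<epsilon> :: real
  assumes "DIM('a::euclidean_space) = d" and "DIM('b::euclidean_space) = d"
    and "1 \<le> k" and "k < d" and "\<epsilon> > 0" and "L > 0"
  shows "(\<exists>N. uniform_DC_bound TYPE('a) k L \<epsilon> N) \<and>
    (\<forall>N. uniform_DC_bound TYPE('a) k L \<epsilon> N \<longrightarrow> uniform_DC_bound TYPE('b) k L \<epsilon> N)"
proof (intro conjI allI impI)
  show "\<exists>N. uniform_DC_bound TYPE('a) k L \<epsilon> N"
    using assms ex_uniform_DC_bound by blast
  fix N assume N: "uniform_DC_bound TYPE('a) k L \<epsilon> N"
  \<comment> \<open>Euclidean spaces of equal dimension are linearly isometric, so the bound for
    \<open>'a\<close> can be transported.\<close>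
  obtain h :: "'b \<Rightarrow> 'a" and h' where h: "linear h" "linear h'" "\<And>x. norm (h x) = norm x"
    "\<And>y. norm (h' y) = norm y" "\<And>x. h' (h x) = x" "\<And>y. h (h' y) = y"
    using assms isomorphisms_UNIV_UNIV[where 'M = 'b and 'N = 'a] by metis
  interpret linear_isometry_pair h h'
    by (rule linear_isometry_pair.intro) (simp_all add: h)
  show "uniform_DC_bound TYPE('b) k L \<epsilon> N"
    using uniform_DC_bound_transfer[OF N] assms by simp
qed

end
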